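(* Let $G$ be a finite, simple, connected graph with minimum degree $\delta(G)\geq 2$ that is an interval graph or a circular arc graph. Then $pc(G)\leq 3$. Moreover, this bound is sharp: there exist connected interval graphs and connected circular arc graphs with minimum degree at least $2$ whose proper connection number equals $3$.
   Context: An interval graph is the intersection graph of a family of intervals on the real line (vertices correspond to intervals, adjacent iff the intervals intersect); a circular arc graph is the intersection graph of a family of arcs on a circle. For an edge-colored graph, a path is a proper path if no two consecutive edges of the path receive the same color. An edge-coloring of a connected graph $G$ is a proper-path coloring if every pair of distinct vertices $u,v$ is joined by a proper $u$-$v$ path. The proper connection number $pc(G)$ is the minimum number of colors in a proper-path coloring of $G$. *)

theory Defs
  imports "HOL-Analysis.Analysis" "Graph_Theory.Graph_Theory"
begin

text \<open>
  Finite simple graphs are \<^const>\<open>pair_graph\<close>s: finite, loop-free, symmetric digraphs without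
  parallel arcs. An undirected edge is the two-element set of its ends, so that an edge-coloring
  assigns one color to both orientations.
\<close>

definition edges :: "'a pair_pre_digraph \<Rightarrow> 'a set set" where
  "edges G = (\<lambda>(u, v). {u, v}) ` parcs G"

text \<open>In a symmetric digraph the out-degree of a vertex is its degree as a graph.\<close>

definition min_degree :: "'a pair_pre_digraph \<Rightarrow> nat" where
  "min_degree G = Min (out_degree (with_proj G) ` pverts G)"

definition intersection_graph :: "'a pair_pre_digraph \<Rightarrow> ('a \<Rightarrow> 'b set) \<Rightarrow> bool" where
  "intersection_graph G S \<longleftrightarrow>
     (\<forall>u\<in>pverts G. \<forall>v\<in>pverts G. u \<noteq> v \<longrightarrow> ((u, v) \<in> parcs G \<longleftrightarrow> S u \<inter> S v \<noteq> {}))"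

definition interval_graph :: "'a pair_pre_digraph \<Rightarrow> bool" where
  "interval_graph G \<longleftrightarrow>
     (\<exists>I :: 'a \<Rightarrow> real set.
        (\<forall>v\<in>pverts G. is_interval (I v) \<and> I v \<noteq> {}) \<and> intersection_graph G I)"

text \<open>Arcs of the unit circle; the full circle and single points are included.\<close>

definition circle_arc :: "complex set \<Rightarrow> bool" where
  "circle_arc A \<longleftrightarrow> (\<exists>J :: real set. is_interval J \<and> J \<noteq> {} \<and> A = cis ` J)"

definition circular_arc_graph :: "'a pair_pre_digraph \<Rightarrow> bool" where
  "circular_arc_graph G \<longleftrightarrow>
     (\<exists>A :: 'a \<Rightarrow> complex set. (\<forall>v\<in>pverts G. circle_arc (A v)) \<and> intersection_graph G A)"

definition proper_path :: "'a pair_pre_digraph \<Rightarrow> ('a set \<Rightarrow> 'c) \<Rightarrow> 'a list \<Rightarrow> bool" where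
  "proper_path G c p \<longleftrightarrow>
     vpath p (with_proj G) \<and>
     (\<forall>i. i + 2 < length p \<longrightarrow> c {p ! i, p ! (i + 1)} \<noteq> c {p ! (i + 1), p ! (i + 2)})"

definition proper_path_coloring :: "'a pair_pre_digraph \<Rightarrow> ('a set \<Rightarrow> 'c) \<Rightarrow> bool" where
  "proper_path_coloring G c \<longleftrightarrow>
     (\<forall>u\<in>pverts G. \<forall>v\<in>pverts G. u \<noteq> v \<longrightarrow>
        (\<exists>p. proper_path G c p \<and> hd p = u \<and> last p = v))"

text \<open>
  A finite connected graph has a proper-path coloring (color its edges injectively), so the
  minimum exists; natural numbers suffice as colors because the edge set is finite.
\<close>

definition proper_connection_number :: "'a pair_pre_digraph \<Rightarrow> nat" where
  "proper_connection_number G =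
     (LEAST k. \<exists>c :: 'a set \<Rightarrow> nat. proper_path_coloring G c \<and> card (c ` edges G) = k)"

end

theory Submission
  imports Defs
begin

text \<open>
  Interval graphs are circular arc graphs, and a connected circular arc graph has a dominating path:
  take a path whose union of arcs contains as many arcs of the graph as possible. If it misses an
  arc, cut the circle inside that arc; then an arc that sticks out of the union can be attached to
  an end of a subpath with the same union, contradicting maximality.

  Given a dominating path, color its edges alternately with 0 and 1 and the edges that join it to the
  other vertices with 2. This fails only for vertices that are confined, together with all their
  neighbours outside the path, to one path vertex \<open>x\<close>. Choose a maximal independent set among these
  vertices; its members get color 0 on the edge to \<open>x\<close>, the others color 1. Then each of them reaches
  \<open>x\<close> properly with two different final colors.

  For sharpness take three triangles sharing a vertex. With two colors, every triangle has a vertex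
  that can enter the hub with one color only, and two of the three triangles agree in that color.
\<close>

subsection \<open>Paths and cuts\<close>

lemma vpath_with_proj_iff:
  "vpath p (with_proj G) \<longleftrightarrow>
     p \<noteq> [] \<and> distinct p \<and> set p \<subseteq> pverts G \<and> successively (\<lambda>u v. (u, v) \<in> parcs G) p"
proof -
  have "set (vwalk_arcs p) \<subseteq> parcs G \<longleftrightarrow> successively (\<lambda>u v. (u, v) \<in> parcs G) p"
    by (induction p rule: vwalk_arcs.induct) auto
  then show ?thesis
    by (auto simp: vpath_def vwalk_def)
qed

context pair_graph
begin

lemma parcs_sym: "(u, v) \<in> parcs G \<longleftrightarrow> (v, u) \<in> parcs G"
  using pair_sym_arcs by (auto simp: symmetric_def sym_def)

lemma vpath_rev: "vpath (rev p) (with_proj G) \<longleftrightarrow> vpath p (with_proj G)"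
  using parcs_sym by (auto simp: vpath_with_proj_iff elim!: successively_mono)

text \<open>When \<open>b\<close> precedes \<open>a\<close> on \<open>p\<close>, the segment is read
  backwards, which symmetry of the arcs allows. The position of \<open>q\<close> in \<open>p\<close>
  is kept so that a coloring alternating along \<open>p\<close> also alternates along
  \<open>q\<close>.\<close>

lemma vpath_subpath:
  assumes p: "vpath p (with_proj G)" and "a \<in> set p" "b \<in> set p"
  obtains q where "vpath q (with_proj G)" "hd q = a" "last q = b"
    "(\<exists>xs ys. p = xs @ q @ ys) \<or> (\<exists>xs ys. p = xs @ rev q @ ys)"
proof -
  obtain xs ys where p_eq: "p = xs @ a # ys"
    using \<open>a \<in> set p\<close> by (auto dest: split_list)
  consider "b = a" | "b \<in> set ys" | "b \<in> set xs"
    using \<open>b \<in> set p\<close> p_eq by auto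
  then show thesis
  proof cases
    case 1
    have "vpath [a] (with_proj G)"
      using p p_eq by (auto simp: vpath_with_proj_iff)
    moreover have "p = xs @ [a] @ ys"
      using p_eq by simp
    ultimately show thesis
      using 1 that[of "[a]"] by auto
  next
    case 2
    then obtain us vs where ys: "ys = us @ b # vs"
      by (auto dest: split_list)
    have eq: "p = xs @ (a # us @ [b]) @ vs"
      using p_eq ys by simp
    have "vpath (a # us @ [b]) (with_proj G)"
      using p unfolding eq vpath_with_proj_iff successively_append_iff by auto
    then show thesis
      using that[of "a # us @ [b]"] eq by auto
  next
    case 3
    then obtain us vs where xs: "xs = us @ b # vs"
      by (auto dest: split_list)
    have eq: "p = us @ (b # vs @ [a]) @ ys"
      using p_eq xs by simp
    have "vpath (b # vs @ [a]) (with_proj G)"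
      using p unfolding eq vpath_with_proj_iff successively_append_iff by auto
    then have "vpath (rev (b # vs @ [a])) (with_proj G)"
      by (simp only: vpath_rev)
    moreover have "p = us @ rev (rev (b # vs @ [a])) @ ys"
      using eq by simp
    ultimately show thesis
      using that[of "rev (b # vs @ [a])"] by auto
  qed
qed

text \<open>A walk from \<open>s\<close> to \<open>t\<close> must leave \<open>S\<close> somewhere;
  such a walk exists because connectedness of a symmetric digraph is strong.\<close>

lemma ex_crossing_arc:
  assumes "Digraph_Component.connected (with_proj G)"
    and "s \<in> S" "s \<in> pverts G" "t \<in> pverts G" "t \<notin> S"
  obtains u v where "(u, v) \<in> parcs G" "u \<in> S" "v \<notin> S"
proof -
  have "strongly_connected (with_proj G)"
    using assms(1) symmetric_connected_imp_strongly_connected pair_sym_arcs by blast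
  then have "(s, t) \<in> (parcs G)\<^sup>*"
    using assms(3,4) reachable_rtranclI[of "with_proj G" s t] by (auto simp: strongly_connected_def)
  then have "\<exists>u v. (u, v) \<in> parcs G \<and> u \<in> S \<and> v \<notin> S"
    using assms(5,2) by (induction rule: converse_rtrancl_induct) auto
  then show thesis
    using that by blast
qed

end

subsection \<open>Cutting the circle at a point\<close>

text \<open>The open window of one full turn omits the cut point \<open>cis \<theta>\<close>; every
  other point of the circle has exactly one parameter in it.\<close>

definition unroll :: "real \<Rightarrow> complex set \<Rightarrow> real set" where
  "unroll \<theta> S = {t. \<theta> < t \<and> t < \<theta> + 2 * pi \<and> cis t \<in> S}"

lemma cis_eq_iff_2pi: "cis s = cis t \<longleftrightarrow> (\<exists>k :: int. s = t + 2 * pi * of_int k)"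
proof -
  have "cis s = cis t \<longleftrightarrow> sin s = sin t \<and> cos s = cos t"
    by (auto simp: complex_eq_iff)
  also have "\<dots> \<longleftrightarrow> (\<exists>k :: int. s = t + 2 * pi * of_int k)"
    using sin_cos_eq_iff[of s t] by (auto simp: algebra_simps)
  finally show ?thesis .
qed

lemma cis_in_image_iff: "cis t \<in> cis ` J \<longleftrightarrow> (\<exists>k :: int. t + 2 * pi * of_int k \<in> J)"
proof
  assume "cis t \<in> cis ` J"
  then obtain s where "s \<in> J" "cis s = cis t"
    by auto
  then show "\<exists>k :: int. t + 2 * pi * of_int k \<in> J"
    by (auto simp: cis_eq_iff_2pi)
next
  assume "\<exists>k :: int. t + 2 * pi * of_int k \<in> J"
  then obtain k :: int where "t + 2 * pi * of_int k \<in> J"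
    by blast
  moreover have "cis t = cis (t + 2 * pi * of_int k)"
    using cis_eq_iff_2pi by metis
  ultimately show "cis t \<in> cis ` J"
    by (rule rev_image_eqI)
qed

text \<open>Every point of \<open>S\<close> has a parameter in the window because \<open>S\<close>
  misses the cut. \<open>T\<close> is arbitrary and may contain the cut point.\<close>

lemma unroll_disjoint_iff:
  assumes "S \<subseteq> range cis" "cis \<theta> \<notin> S"
  shows "unroll \<theta> S \<inter> unroll \<theta> T = {} \<longleftrightarrow> S \<inter> T = {}"
proof -
  have "\<exists>t. \<theta> < t \<and> t < \<theta> + 2 * pi \<and> cis t = z" if "z \<in> S" for z
  proof -
    obtain s where s: "z = cis s"
      using \<open>z \<in> S\<close> assms(1) by auto
    \<comment> \<open>\<open>k\<close> counts full turns, so \<open>t\<close> lands in the half-open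
      window from \<open>\<theta>\<close>; its left end is excluded because
      \<open>cis \<theta>\<close> is not in \<open>S\<close>.\<close>
    define k where "k = \<lfloor>(s - \<theta>) / (2 * pi)\<rfloor>"
    define t where "t = s - 2 * pi * of_int k"
    have t: "cis t = z"
      unfolding s cis_eq_iff_2pi by (intro exI[of _ "- k"]) (simp add: t_def)
    have "of_int k \<le> (s - \<theta>) / (2 * pi)" "(s - \<theta>) / (2 * pi) < of_int k + 1"
      unfolding k_def by linarith+
    then have "of_int k * (2 * pi) \<le> s - \<theta>" "s - \<theta> < (of_int k + 1) * (2 * pi)"
      by (simp_all add: pos_le_divide_eq pos_divide_less_eq)
    then have "\<theta> \<le> t" "t < \<theta> + 2 * pi"
      by (simp_all add: t_def algebra_simps)
    moreover have "t \<noteq> \<theta>"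
      using t that assms(2) by auto
    ultimately show ?thesis
      using t by (auto intro!: exI[of _ t])
  qed
  then show ?thesis
    unfolding unroll_def by blast
qed

text \<open>Inclusion in \<open>T\<close> is disjointness from the complement of
  \<open>T\<close>.\<close>

lemma unroll_subset_iff:
  assumes "S \<subseteq> range cis" "cis \<theta> \<notin> S"
  shows "unroll \<theta> S \<subseteq> unroll \<theta> T \<longleftrightarrow> S \<subseteq> T"
  using unroll_disjoint_iff[of S \<theta> "- T"] assms by (auto simp: unroll_def)

lemma circle_arc_subset_range: "circle_arc S \<Longrightarrow> S \<subseteq> range cis"
  by (auto simp: circle_arc_def)

text \<open>The interval \<open>J\<close> contains no translate of \<open>\<theta>\<close> by full
  turns, so it lies between two consecutive translates and the unrolled set is a shifted copy of
  it.\<close>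

lemma is_interval_unroll:
  assumes "circle_arc S" "cis \<theta> \<notin> S"
  shows "is_interval (unroll \<theta> S)"
proof -
  obtain J :: "real set" where J: "is_interval J" "S = cis ` J"
    using assms(1) by (auto simp: circle_arc_def)
  have avoid: "\<theta> + 2 * pi * of_int k \<notin> J" for k :: int
    using assms(2) by (auto simp: J(2) cis_in_image_iff)
  have "x \<in> unroll \<theta> S" if t: "t1 \<in> unroll \<theta> S" "t2 \<in> unroll \<theta> S" "t1 \<le> x" "x \<le> t2" for t1 t2 x
  proof -
    obtain s1 k1 where 1: "s1 \<in> J" "s1 = t1 + 2 * pi * of_int k1"
      using t(1) by (auto simp: J(2) unroll_def cis_in_image_iff)
    obtain s2 k2 where 2: "s2 \<in> J" "s2 = t2 + 2 * pi * of_int k2"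
      using t(2) by (auto simp: J(2) unroll_def cis_in_image_iff)
    \<comment> \<open>Points of \<open>J\<close> from windows \<open>m < n\<close> would enclose the
      translate of \<open>\<theta>\<close> at which window \<open>n\<close> starts.\<close>
    have sep: False
      if "m < n" "a \<in> J" "b \<in> J" "a = t + 2 * pi * of_int m" "b = t' + 2 * pi * of_int n"
      "t < \<theta> + 2 * pi" "\<theta> < t'" for m n :: int and a b t t'
    proof -
      have "of_int (m + 1) \<le> (of_int n :: real)"
        using \<open>m < n\<close> by linarith
      then have "2 * pi * of_int (m + 1) \<le> 2 * pi * of_int n"
        by (intro mult_left_mono) auto
      then have "a \<le> \<theta> + 2 * pi * of_int n" "\<theta> + 2 * pi * of_int n \<le> b"
        using that by (auto simp: algebra_simps)
      then show False
        using mem_is_interval_1_I[OF J(1) that(2,3)] avoid by blast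
    qed
    have "k1 = k2"
    proof (cases k1 k2 rule: linorder_cases)
      case less
      then show ?thesis
        using sep[OF _ 1(1) 2(1) 1(2) 2(2)] t by (simp add: unroll_def)
    next
      case greater
      then show ?thesis
        using sep[OF _ 2(1) 1(1) 2(2) 1(2)] t by (simp add: unroll_def)
    qed
    then have "x + 2 * pi * of_int k1 \<in> J"
      using 1 2 t by - (rule mem_is_interval_1_I[OF J(1), of s1 s2], auto)
    then show ?thesis
      using t by (auto simp: J(2) unroll_def cis_in_image_iff)
  qed
  then show ?thesis
    unfolding is_interval_1 by blast
qed

text \<open>An arc through the cut may unroll into two pieces, one at each end of the window.
  \<open>J\<close> joins a translate of \<open>t\<close> to a translate of \<open>\<theta>\<close>,
  and their order decides which end is filled from \<open>t\<close>.\<close>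

lemma unroll_through_cut:
  assumes "circle_arc S" "cis \<theta> \<in> S" "t \<in> unroll \<theta> S"
  shows "{\<theta><..t} \<subseteq> unroll \<theta> S \<or> {t..<\<theta> + 2 * pi} \<subseteq> unroll \<theta> S"
proof -
  obtain J :: "real set" where J: "is_interval J" "S = cis ` J"
    using assms(1) by (auto simp: circle_arc_def)
  obtain r m where r: "r \<in> J" "r = \<theta> + 2 * pi * of_int m"
    using assms(2) by (auto simp: J(2) cis_in_image_iff)
  obtain s k where s: "s \<in> J" "s = t + 2 * pi * of_int k"
    using assms(3) by (auto simp: J(2) unroll_def cis_in_image_iff)
  have t: "\<theta> < t" "t < \<theta> + 2 * pi"
    using assms(3) by (auto simp: unroll_def)
  have shift: "x \<in> unroll \<theta> S"
    if "\<theta> < x" "x < \<theta> + 2 * pi" "x + 2 * pi * of_int n \<in> J" for x and n :: int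
    using that by (auto simp: J(2) unroll_def cis_in_image_iff)
  show ?thesis
  proof (cases "m \<le> k")
    case True
    then have le: "2 * pi * of_int m \<le> 2 * pi * of_int k"
      by (intro mult_left_mono) auto
    have "x + 2 * pi * of_int m \<in> J" if "\<theta> < x" "x \<le> t" for x
    proof -
      have "r \<le> x + 2 * pi * of_int m" "x + 2 * pi * of_int m \<le> s"
        using r s that le by linarith+
      then show ?thesis
        using r s mem_is_interval_1_I[OF J(1)] by blast
    qed
    then have "{\<theta><..t} \<subseteq> unroll \<theta> S"
      using shift[of _ m] t by auto
    then show ?thesis ..
  next
    case False
    then have "of_int (k + 1) \<le> (of_int m :: real)"
      by linarith
    then have le: "2 * pi * of_int (k + 1) \<le> 2 * pi * of_int m"
      by (intro mult_left_mono) auto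
    \<comment> \<open>\<open>r\<close> is the right end of window \<open>m - 1\<close>, hence the
      shift by one turn less.\<close>
    have "x + 2 * pi * of_int (m - 1) \<in> J" if "t \<le> x" "x < \<theta> + 2 * pi" for x
    proof -
      have "s \<le> x + 2 * pi * of_int (m - 1)" "x + 2 * pi * of_int (m - 1) \<le> r"
        using r s that le by (auto simp: algebra_simps)
      then show ?thesis
        using r s mem_is_interval_1_I[OF J(1)] by blast
    qed
    then have "{t..<\<theta> + 2 * pi} \<subseteq> unroll \<theta> S"
      using shift t by (meson atLeastLessThan_iff less_le_trans subsetI)
    then show ?thesis ..
  qed
qed

text \<open>\<open>arctan\<close> maps the line into an open interval of length \<open>pi\<close>,
  on which \<open>cis\<close> is injective. An injective map neither creates nor destroys
  intersections.\<close>

lemma interval_graph_imp_circular_arc_graph: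
  assumes "interval_graph G"
  shows "circular_arc_graph G"
proof -
  obtain I :: "'a \<Rightarrow> real set"
    where I: "\<And>v. v \<in> pverts G \<Longrightarrow> is_interval (I v) \<and> I v \<noteq> {}" and G: "intersection_graph G I"
    using assms by (auto simp: interval_graph_def)
  define f where "f x = cis (arctan x)" for x
  have inj: "inj f"
  proof (rule injI)
    fix x y
    assume "f x = f y"
    then have "sin (arctan x) = sin (arctan y)"
      by (auto simp: f_def complex_eq_iff)
    then have "arctan x = arctan y"
      using arctan_lbound[of x] arctan_ubound[of x] arctan_lbound[of y] arctan_ubound[of y]
      by - (rule sin_inj_pi, auto)
    then show "x = y"
      by (simp add: arctan_eq_iff)
  qed
  have "circle_arc (f ` I v)" if "v \<in> pverts G" for v
  proof -
    have "is_interval (arctan ` I v)"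
      using I[OF that]
      by (auto simp: is_interval_connected_1 intro!: connected_continuous_image continuous_intros)
    then show ?thesis
      using I[OF that]
      by (auto simp: circle_arc_def f_def image_image intro!: exI[of _ "arctan ` I v"])
  qed
  moreover have "intersection_graph G (\<lambda>v. f ` I v)"
    using G inj by (simp add: intersection_graph_def image_Int[symmetric])
  ultimately show ?thesis
    unfolding circular_arc_graph_def by (intro exI[of _ "\<lambda>v. f ` I v"]) blast
qed

subsection \<open>Dominating paths\<close>

text \<open>Ends of intervals need not be attained, so the member reaching furthest is singled out
  by domination instead of by a maximum.\<close>

lemma ex_cofinal_set:
  fixes B :: "'b \<Rightarrow> 'c :: linorder set"
  assumes "finite F" "F \<noteq> {}"
  shows "\<exists>m\<in>F. \<forall>x\<in>(\<Union>v\<in>F. B v). \<exists>y\<in>B m. x \<le> y"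
  using assms
proof (induction F rule: finite_ne_induct)
  case (singleton v)
  then show ?case by auto
next
  case (insert v F)
  then obtain m where m: "m \<in> F" "\<forall>x\<in>(\<Union>v\<in>F. B v). \<exists>y\<in>B m. x \<le> y"
    by blast
  show ?case
  proof (cases "\<forall>x\<in>B v. \<exists>y\<in>B m. x \<le> y")
    case True
    then show ?thesis
      using m by blast
  next
    \<comment> \<open>Some \<open>z\<close> in \<open>B v\<close> lies above all of
      \<open>B m\<close>, so \<open>v\<close> dominates everything that \<open>m\<close>
      did.\<close>
    case False
    then obtain z where z: "z \<in> B v" "\<forall>y\<in>B m. y \<le> z"
      by (auto simp: not_le intro: less_imp_le)
    have "\<exists>y\<in>B v. x \<le> y" if x: "x \<in> (\<Union>u\<in>insert v F. B u)" for x
    proof (cases "x \<in> B v")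
      case True
      then show ?thesis
        by blast
    next
      case False
      then obtain y where "y \<in> B m" "x \<le> y"
        using x m(2) by (metis UN_I UN_iff insertE)
      then show ?thesis
        using z by (intro bexI[of _ z]) auto
    qed
    then show ?thesis
      by blast
  qed
qed

lemma ex_coinitial_set:
  fixes B :: "'b \<Rightarrow> real set"
  assumes "finite F" "F \<noteq> {}"
  shows "\<exists>m\<in>F. \<forall>x\<in>(\<Union>v\<in>F. B v). \<exists>y\<in>B m. y \<le> x"
  using ex_cofinal_set[OF assms, of "\<lambda>v. uminus ` B v"] by simp

text \<open>Overlaps of consecutive members make the union connected, and connected sets of reals
  are intervals.\<close>

lemma is_interval_Union_chain:
  fixes B :: "'b \<Rightarrow> real set"
  assumes "successively (\<lambda>u v. B u \<inter> B v \<noteq> {}) p" "\<And>v. v \<in> set p \<Longrightarrow> is_interval (B v)"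
  shows "is_interval (\<Union>v\<in>set p. B v)"
  using assms
proof (induction p rule: induct_list012)
  case (3 u v p)
  have "is_interval (B u)" "is_interval (\<Union>v\<in>set (v # p). B v)"
    using 3 by auto
  moreover have "B u \<inter> (\<Union>v\<in>set (v # p). B v) \<noteq> {}"
    using 3 by auto
  ultimately have "is_interval (B u \<union> (\<Union>v\<in>set (v # p). B v))"
    unfolding is_interval_connected_1 by (rule connected_Un)
  then show ?case
    by simp
qed auto

section \<open>Growing a path of arcs until it dominates\<close>

definition dominating_path :: "'a pair_pre_digraph \<Rightarrow> 'a list \<Rightarrow> bool" where
  "dominating_path G p \<longleftrightarrow>
     vpath p (with_proj G) \<and> (\<forall>v\<in>pverts G. v \<notin> set p \<longrightarrow> (\<exists>x\<in>set p. (v, x) \<in> parcs G))"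

context pair_graph
begin

text \<open>
  After cutting the circle outside the union of the path, some member \<open>a\<close> of the path reaches furthest
  to the left and some member \<open>b\<close> furthest to the right. The subpath from \<open>a\<close> to \<open>b\<close> has the same
  union, and an arc that meets the union and sticks out of it meets \<open>a\<close> or \<open>b\<close>.
\<close>

lemma extend_arc_path:
  assumes arc: "\<And>v. v \<in> pverts G \<Longrightarrow> circle_arc (A v)" and rep: "intersection_graph G A"
    and p: "vpath p (with_proj G)" and cut: "cis \<theta> \<notin> (\<Union>v\<in>set p. A v)"
    and w: "w \<in> pverts G" "A w \<inter> (\<Union>v\<in>set p. A v) \<noteq> {}" "\<not> A w \<subseteq> (\<Union>v\<in>set p. A v)"
  obtains p' where "vpath p' (with_proj G)" "(\<Union>v\<in>set p. A v) \<union> A w \<subseteq> (\<Union>v\<in>set p'. A v)"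
proof -
  let ?U = "\<Union>v\<in>set p. A v"
  define B where "B v = unroll \<theta> (A v)" for v
  have p_verts: "set p \<subseteq> pverts G" "p \<noteq> []"
    using p by (auto simp: vpath_with_proj_iff)
  have U_eq: "unroll \<theta> (\<Union>v\<in>X. A v) = (\<Union>v\<in>X. B v)" for X
    by (auto simp: B_def unroll_def)
  have B_int: "is_interval (B v)" if "v \<in> set p" for v
    unfolding B_def using that p_verts arc cut by (intro is_interval_unroll) auto
  have B_meet: "B u \<inter> B v \<noteq> {}" if "(u, v) \<in> parcs G" "u \<in> set p" "v \<in> set p" for u v
  proof -
    have "u \<noteq> v"
      using that pair_no_loops by fastforce
    then have "A u \<inter> A v \<noteq> {}"
      using that p_verts rep by (auto simp: intersection_graph_def)
    moreover have "A u \<subseteq> range cis" "cis \<theta> \<notin> A u"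
      using that p_verts arc cut by (auto dest!: subsetD intro!: circle_arc_subset_range)
    ultimately show ?thesis
      by (simp add: B_def unroll_disjoint_iff)
  qed
  obtain a where a: "a \<in> set p" "\<And>x. x \<in> (\<Union>v\<in>set p. B v) \<Longrightarrow> \<exists>y\<in>B a. y \<le> x"
    using ex_coinitial_set[of "set p" B] p_verts(2) by (metis List.finite_set set_empty)
  obtain b where b: "b \<in> set p" "\<And>x. x \<in> (\<Union>v\<in>set p. B v) \<Longrightarrow> \<exists>y\<in>B b. x \<le> y"
    using ex_cofinal_set[of "set p" B] p_verts(2) by (metis List.finite_set set_empty)
  obtain q where q: "vpath q (with_proj G)" "hd q = a" "last q = b"
    and "(\<exists>xs ys. p = xs @ q @ ys) \<or> (\<exists>xs ys. p = xs @ rev q @ ys)"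
    using vpath_subpath[OF p a(1) b(1)] .
  then have q_sub: "set q \<subseteq> set p"
    by auto
  have q_ne: "q \<noteq> []" and q_chain: "successively (\<lambda>u v. (u, v) \<in> parcs G) q"
    using q(1) by (auto simp: vpath_with_proj_iff)
  then have ab_q: "a \<in> set q" "b \<in> set q"
    using q(2,3) by auto
  have "successively (\<lambda>u v. B u \<inter> B v \<noteq> {}) q"
    using q_chain by (rule successively_mono) (use B_meet q_sub in blast)
  then have interval_q: "is_interval (\<Union>v\<in>set q. B v)"
    using B_int q_sub by (intro is_interval_Union_chain) auto
  \<comment> \<open>Each point of the full union lies between a point of \<open>B a\<close> and a
    point of \<open>B b\<close>, and the union along \<open>q\<close> is an interval containing
    both.\<close>
  have "x \<in> (\<Union>v\<in>set q. B v)" if x: "x \<in> (\<Union>v\<in>set p. B v)" for x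
  proof -
    obtain y z where "y \<in> B a" "y \<le> x" "z \<in> B b" "x \<le> z"
      using a(2)[OF x] b(2)[OF x] by blast
    then show ?thesis
      using ab_q by (intro mem_is_interval_1_I[OF interval_q, of y z x]) auto
  qed
  then have "unroll \<theta> ?U \<subseteq> unroll \<theta> (\<Union>v\<in>set q. A v)"
    unfolding U_eq by blast
  moreover have "?U \<subseteq> range cis"
    using p_verts arc circle_arc_subset_range by blast
  ultimately have U_sub: "?U \<subseteq> (\<Union>v\<in>set q. A v)"
    by (simp only: unroll_subset_iff[OF _ cut])
  have interval_p: "is_interval (\<Union>v\<in>set p. B v)"
    using p B_meet B_int
    by (intro is_interval_Union_chain) (auto simp: vpath_with_proj_iff elim!: successively_mono)
  obtain x where x: "x \<in> B w" "x \<in> (\<Union>v\<in>set p. B v)"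
    using w(2) unroll_disjoint_iff[of ?U \<theta> "A w"] \<open>?U \<subseteq> range cis\<close> cut
    unfolding U_eq B_def by blast
  \<comment> \<open>From \<open>x\<close>, the set \<open>B w\<close> covers one whole side of the
    union. If \<open>A w\<close> contains the cut, it reaches an end of the window; otherwise
    \<open>B w\<close> is an interval with a point \<open>z\<close> beyond an end of the
    union.\<close>
  have direction: "(\<forall>y\<in>\<Union>v\<in>set p. B v. y \<le> x \<longrightarrow> y \<in> B w) \<or>
      (\<forall>y\<in>\<Union>v\<in>set p. B v. x \<le> y \<longrightarrow> y \<in> B w)"
  proof (cases "cis \<theta> \<in> A w")
    case True
    have "{\<theta><..x} \<subseteq> B w \<or> {x..<\<theta> + 2 * pi} \<subseteq> B w"
      using unroll_through_cut[OF arc[OF w(1)] True] x(1) unfolding B_def by blast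
    moreover have "\<theta> < y \<and> y < \<theta> + 2 * pi" if "y \<in> (\<Union>v\<in>set p. B v)" for y
      using that by (auto simp: B_def unroll_def)
    ultimately show ?thesis
      by fastforce
  next
    case False
    then have Bw: "is_interval (B w)"
      unfolding B_def using arc w(1) by (intro is_interval_unroll)
    have "\<not> B w \<subseteq> (\<Union>v\<in>set p. B v)"
      using w(3) unroll_subset_iff[of "A w" \<theta> ?U] arc[OF w(1)] circle_arc_subset_range False
      unfolding U_eq B_def by blast
    then obtain z where z: "z \<in> B w" "z \<notin> (\<Union>v\<in>set p. B v)"
      by blast
    show ?thesis
    proof (cases "z \<le> x")
      case True
      have "z \<le> y" if "y \<in> (\<Union>v\<in>set p. B v)" for y
        using mem_is_interval_1_I[OF interval_p that x(2), of z] z(2) True by linarith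
      then show ?thesis
        using mem_is_interval_1_I[OF Bw z(1) x(1)] by blast
    next
      case False
      have "y \<le> z" if "y \<in> (\<Union>v\<in>set p. B v)" for y
        using mem_is_interval_1_I[OF interval_p x(2) that, of z] z(2) False by linarith
      then show ?thesis
        using mem_is_interval_1_I[OF Bw x(1) z(1)] by blast
    qed
  qed
  have w_notin: "w \<notin> set p"
    using w(3) by auto
  have adj: "(w, v) \<in> parcs G" if "v \<in> set p" "y \<in> B v" "y \<in> B w" for v y
  proof -
    have "A w \<inter> A v \<noteq> {}"
      using that by (auto simp: B_def unroll_def)
    moreover have "v \<in> pverts G" "w \<noteq> v"
      using that(1) p_verts w_notin by auto
    ultimately show ?thesis
      using rep w(1) by (simp add: intersection_graph_def)
  qed
  \<comment> \<open>On the side covered by \<open>B w\<close>, the extremal vertex \<open>a\<close>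
    or \<open>b\<close> has a point at or beyond \<open>x\<close>, so its arc meets that of
    \<open>w\<close>.\<close>
  have "(w, a) \<in> parcs G \<or> (w, b) \<in> parcs G"
    using direction
  proof
    assume left: "\<forall>y\<in>\<Union>v\<in>set p. B v. y \<le> x \<longrightarrow> y \<in> B w"
    obtain y where "y \<in> B a" "y \<le> x"
      using a(2)[OF x(2)] by blast
    then show ?thesis
      using adj[OF a(1)] a(1) left by blast
  next
    assume right: "\<forall>y\<in>\<Union>v\<in>set p. B v. x \<le> y \<longrightarrow> y \<in> B w"
    obtain y where "y \<in> B b" "x \<le> y"
      using b(2)[OF x(2)] by blast
    then show ?thesis
      using adj[OF b(1)] b(1) right by blast
  qed
  then show thesis
  proof
    assume "(w, a) \<in> parcs G"
    then have "vpath (w # q) (with_proj G)"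
      using q w_notin q_sub w(1) by (auto simp: vpath_with_proj_iff successively_Cons)
    then show thesis
      using U_sub by (intro that[of "w # q"]) auto
  next
    assume "(w, b) \<in> parcs G"
    then have "vpath (q @ [w]) (with_proj G)"
      using q w_notin q_sub w(1) parcs_sym
      by (auto simp: vpath_with_proj_iff successively_append_iff)
    then show thesis
      using U_sub by (intro that[of "q @ [w]"]) auto
  qed
qed

text \<open>The maximized quantity is the number of arcs inside the union and not the length of the
  path: an extension may first pass to a shorter subpath, but it never loses coverage.\<close>

lemma circular_arc_graph_dominating_path:
  assumes conn: "Digraph_Component.connected (with_proj G)" and "circular_arc_graph G"
  obtains p where "dominating_path G p"
proof -
  obtain A :: "'a \<Rightarrow> complex set"
    where arc: "\<And>v. v \<in> pverts G \<Longrightarrow> circle_arc (A v)" and rep: "intersection_graph G A"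
    using assms(2) by (auto simp: circular_arc_graph_def)
  define covered where "covered p = {v \<in> pverts G. A v \<subseteq> (\<Union>u\<in>set p. A u)}" for p
  obtain v0 where "v0 \<in> pverts G"
    using conn by (auto simp: connected_conv)
  then have "vpath [v0] (with_proj G)"
    by (simp add: vpath_with_proj_iff)
  moreover have "card (covered p) \<le> card (pverts G)" for p
    using pair_finite_verts by (intro card_mono) (auto simp: covered_def)
  then have "\<forall>p. vpath p (with_proj G) \<longrightarrow> card (covered p) < Suc (card (pverts G))"
    by (simp add: less_Suc_eq_le)
  ultimately obtain p where p: "vpath p (with_proj G)"
    and maximal: "\<And>q. vpath q (with_proj G) \<Longrightarrow> card (covered q) \<le> card (covered p)"
    using ex_has_greatest_nat[of "\<lambda>p. vpath p (with_proj G)" _ "\<lambda>p. card (covered p)"] by metis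
  have p_verts: "set p \<subseteq> pverts G" "p \<noteq> []"
    using p by (auto simp: vpath_with_proj_iff)
  have "\<exists>x\<in>set p. (v, x) \<in> parcs G" if v: "v \<in> pverts G" "v \<notin> set p" for v
  proof (rule ccontr)
    assume nonadj: "\<not> (\<exists>x\<in>set p. (v, x) \<in> parcs G)"
    then have disj: "A v \<inter> (\<Union>u\<in>set p. A u) = {}"
      using v p_verts rep by (force simp: intersection_graph_def)
    obtain \<theta> where \<theta>: "cis \<theta> \<in> A v"
      using arc[OF v(1)] by (auto simp: circle_arc_def)
    have "hd p \<in> covered p" "hd p \<in> pverts G" "v \<notin> covered p"
      using p_verts disj \<theta> by (auto simp: covered_def)
    \<comment> \<open>The arc of \<open>w\<close> meets the union through \<open>A s\<close> but is
      not contained in it, as the extension requires; the cut is placed inside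
      \<open>A v\<close>.\<close>
    then obtain s w where sw: "(s, w) \<in> parcs G" "s \<in> covered p" "w \<notin> covered p"
      using ex_crossing_arc[OF conn] v(1) by metis
    have w: "w \<in> pverts G" "s \<noteq> w"
      using sw arc_snd_in_verts by force+
    have "A s \<inter> A w \<noteq> {}"
      using sw w rep by (auto simp: covered_def intersection_graph_def)
    then have "A w \<inter> (\<Union>u\<in>set p. A u) \<noteq> {}" "\<not> A w \<subseteq> (\<Union>u\<in>set p. A u)"
      using sw w by (auto simp: covered_def)
    then obtain p' where p': "vpath p' (with_proj G)"
      "(\<Union>u\<in>set p. A u) \<union> A w \<subseteq> (\<Union>u\<in>set p'. A u)"
      using extend_arc_path[OF arc rep p _ w(1)] \<theta> disj by (metis disjoint_iff)
    have "covered p \<subseteq> covered p'" "w \<in> covered p'"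
      using p'(2) w(1) unfolding covered_def by blast+
    then have "card (covered p) < card (covered p')"
      using sw(3) pair_finite_verts by (intro psubset_card_mono) (auto simp: covered_def)
    then show False
      using maximal[OF p'(1)] by simp
  qed
  then show thesis
    using p that by (auto simp: dominating_path_def)
qed

end

subsection \<open>Three colors suffice around a dominating path\<close>

fun uedges :: "'a list \<Rightarrow> 'a set list" where
  "uedges (x # y # p) = {x, y} # uedges (y # p)"
| "uedges _ = []"

lemma length_uedges: "length (uedges p) = length p - 1"
  by (induction p rule: uedges.induct) auto

lemma nth_uedges: "i + 1 < length p \<Longrightarrow> uedges p ! i = {p ! i, p ! (i + 1)}"
  by (induction p arbitrary: i rule: uedges.induct) (auto simp: nth_Cons split: nat.splits)

text \<open>The vertex \<open>x\<close> is shared by both parts, so that no edge is lost at the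
  split.\<close>

lemma uedges_append: "uedges (xs @ x # ys) = uedges (xs @ [x]) @ uedges (x # ys)"
  by (induction xs rule: induct_list012) auto

lemma uedges_rev: "uedges (rev p) = rev (uedges p)"
proof (induction p rule: uedges.induct)
  case (1 x y p)
  have "uedges (rev (x # y # p)) = uedges (rev p @ y # [x])"
    by simp
  also have "\<dots> = uedges (rev (y # p)) @ [{y, x}]"
    by (subst uedges_append) simp
  finally show ?case
    using 1 by (simp add: insert_commute)
qed auto

lemma uedges_eq_Nil_iff: "uedges p = [] \<longleftrightarrow> length p \<le> 1"
  by (cases p rule: uedges.cases) auto

lemma hd_uedges: "q \<noteq> [] \<Longrightarrow> hd (uedges (x # q)) = {x, hd q}"
  by (cases q) auto

lemma last_uedges: "h \<noteq> [] \<Longrightarrow> last (uedges (h @ [x])) = {last h, x}"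
  by (cases h rule: rev_cases) (simp_all add: uedges_append[of _ _ "[x]"])

lemma uedges_subset: "e \<in> set (uedges p) \<Longrightarrow> e \<subseteq> set p"
  by (induction p rule: uedges.induct) auto

text \<open>Properness becomes a condition on one list of colors, which behaves well under append
  and reversal.\<close>

lemma proper_path_iff:
  "proper_path G c p \<longleftrightarrow> vpath p (with_proj G) \<and> distinct_adj (map c (uedges p))"
  by (auto simp: proper_path_def distinct_adj_conv_nth length_uedges nth_uedges)

text \<open>By distinctness the first edge does not recur later, so its color can be set opposite to
  that of the second edge.\<close>

lemma ex_alternating_coloring:
  assumes "distinct p"
  obtains f :: "'a set \<Rightarrow> nat" where "\<And>e. f e < 2" "distinct_adj (map f (uedges p))"
proof -
  have "\<exists>f :: 'a set \<Rightarrow> nat. (\<forall>e. f e < 2) \<and> distinct_adj (map f (uedges p))"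
    using assms
  proof (induction p rule: uedges.induct)
    case (1 x y p)
    then obtain f :: "'a set \<Rightarrow> nat" where f: "\<forall>e. f e < 2" "distinct_adj (map f (uedges (y # p)))"
      by auto
    \<comment> \<open>If no edge follows, \<open>hd\<close> is unspecified; the color is still below
      2 and there is nothing to differ from.\<close>
    define g where "g = f({x, y} := 1 - f (hd (uedges (y # p))))"
    have g_lt: "g e < 2" for e
      using f(1) by (auto simp: g_def)
    have "{x, y} \<notin> set (uedges (y # p))"
      using uedges_subset[of "{x, y}" "y # p"] 1(2) by auto
    then have g_eq: "map g (uedges (y # p)) = map f (uedges (y # p))"
      by (auto simp: g_def)
    have "g {x, y} \<noteq> f e" if "e = hd (uedges (y # p))" for e
      using f(1)[THEN spec, of e] that by (simp add: g_def) presburger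
    moreover have "distinct_adj (map g (uedges (y # p)))"
      using f(2) by (simp only: g_eq)
    ultimately have "distinct_adj (map g (uedges (x # y # p)))"
      using g_eq by (cases "uedges (y # p)") (auto simp: distinct_adj_Cons)
    then show ?case
      using g_lt by blast
  qed (auto intro: exI[of _ "\<lambda>_. 0"])
  then show thesis
    using that by blast
qed

text \<open>Take an inclusion-maximal independent subset; an element unrelated to all of it could be
  added.\<close>

lemma ex_maximal_independent_set:
  assumes "finite T" "\<And>u v. R u v \<Longrightarrow> R v u" "\<And>u. \<not> R u u"
  obtains I where "I \<subseteq> T" "\<And>u v. u \<in> I \<Longrightarrow> v \<in> I \<Longrightarrow> \<not> R u v"
    "\<And>u. u \<in> T \<Longrightarrow> u \<notin> I \<Longrightarrow> \<exists>v\<in>I. R u v"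
proof -
  define \<I> where "\<I> = {I. I \<subseteq> T \<and> (\<forall>u\<in>I. \<forall>v\<in>I. \<not> R u v)}"
  have "finite \<I>" "\<I> \<noteq> {}"
    using assms(1) by (auto simp: \<I>_def)
  then obtain I where I: "I \<in> \<I>" "\<And>J. J \<in> \<I> \<Longrightarrow> I \<subseteq> J \<Longrightarrow> J = I"
    using finite_has_maximal[of \<I>] by metis
  have "\<exists>v\<in>I. R u v" if "u \<in> T" "u \<notin> I" for u
  proof (rule ccontr)
    assume "\<not> (\<exists>v\<in>I. R u v)"
    then have "insert u I \<in> \<I>"
      using I(1) that(1) assms(2,3) by (auto simp: \<I>_def)
    then show False
      using I(2) that(2) by blast
  qed
  then show thesis
    using that[of I] I(1) by (auto simp: \<I>_def)
qed

section \<open>Reversing and gluing proper paths\<close>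

context pair_graph
begin

lemma proper_path_rev: "proper_path G c (rev p) \<longleftrightarrow> proper_path G c p"
  by (simp add: proper_path_iff vpath_rev uedges_rev rev_map[symmetric])

text \<open>The only new pair of consecutive edges is the one at \<open>x\<close>, and it exists
  only if both \<open>h\<close> and \<open>q\<close> are nonempty.\<close>

lemma proper_path_join:
  assumes "proper_path G c (h @ [x])" "proper_path G c (x # q)" "set h \<inter> set q = {}"
    and "h \<noteq> [] \<Longrightarrow> q \<noteq> [] \<Longrightarrow> c {last h, x} \<noteq> c {x, hd q}"
  shows "proper_path G c (h @ x # q)"
proof -
  have "vpath (h @ x # q) (with_proj G)"
    using assms(1-3) by (auto simp: proper_path_iff vpath_with_proj_iff successively_append_iff)
  moreover have "distinct_adj (map c (uedges (h @ x # q)))"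
  proof (cases "h = [] \<or> q = []")
    case True
    then show ?thesis
      using assms(1,2) by (auto simp: proper_path_iff)
  next
    case False
    then have "uedges (h @ [x]) \<noteq> []" "uedges (x # q) \<noteq> []"
      by (auto simp: uedges_eq_Nil_iff Suc_le_eq)
    then show ?thesis
      using assms False unfolding uedges_append[of h x q]
      by (auto simp: proper_path_iff distinct_adj_append_iff last_map hd_map hd_uedges last_uedges)
  qed
  ultimately show ?thesis
    by (simp add: proper_path_iff)
qed

definition linked :: "('a set \<Rightarrow> 'c) \<Rightarrow> 'a \<Rightarrow> 'a \<Rightarrow> bool" where
  "linked c u v \<longleftrightarrow> (\<exists>p. proper_path G c p \<and> hd p = u \<and> last p = v)"

lemma linked_sym: "linked c u v \<Longrightarrow> linked c v u"
  unfolding linked_def by (metis proper_path_rev hd_rev last_rev)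

lemma proper_path_arc:
  assumes "(u, v) \<in> parcs G"
  shows "proper_path G c [u, v]"
  using assms pair_no_loops[of "(u, v)"] arc_fst_in_verts[of "(u, v)"] arc_snd_in_verts[of "(u, v)"]
  by (auto simp: proper_path_iff vpath_with_proj_iff)

lemma linked_arc: "(u, v) \<in> parcs G \<Longrightarrow> linked c u v"
  unfolding linked_def using proper_path_arc[of u v c] by fastforce

end

text \<open>\<open>second_neighbour\<close> is minimum degree 2 in the form used later: no vertex
  has all its neighbours equal to one \<open>x\<close>.\<close>

locale dominated_pair_graph = pair_graph +
  fixes P :: "'a list"
  assumes dominating: "dominating_path G P"
    and second_neighbour: "\<And>v x. v \<in> pverts G \<Longrightarrow> \<exists>u. (v, u) \<in> parcs G \<and> u \<noteq> x"
begin

definition outer :: "'a set" where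
  "outer = pverts G - set P"

definition contacts :: "'a \<Rightarrow> 'a set" where
  "contacts u = {x \<in> set P. (u, x) \<in> parcs G}"

text \<open>
  For an outer vertex that is not captive, contact edges of a single color suffice: it reaches \<open>P\<close> at
  two different vertices, possibly through an outer neighbour. A captive vertex reaches \<open>P\<close> in one
  vertex only, and must therefore be able to arrive there with two different colors.
\<close>

definition captive :: "'a set" where
  "captive = {u \<in> outer. (\<exists>x. contacts u = {x}) \<and>
     (\<forall>v\<in>outer. (u, v) \<in> parcs G \<longrightarrow> contacts v = contacts u)}"

lemma contacts_nonempty: "u \<in> outer \<Longrightarrow> contacts u \<noteq> {}"
  using dominating by (auto simp: outer_def contacts_def dominating_path_def)

lemma outer_or_path: "v \<in> pverts G \<Longrightarrow> v \<in> outer \<or> v \<in> set P"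
  by (auto simp: outer_def)

end

text \<open>\<open>I\<close> splits the captive vertices in two classes such that each captive
  vertex with a captive neighbour also has one in the opposite class.\<close>

locale colored_dominated_pair_graph = dominated_pair_graph +
  fixes f :: "'a set \<Rightarrow> nat" and I :: "'a set"
  assumes f_less: "\<And>e. f e < 2"
    and f_alternating: "distinct_adj (map f (uedges P))"
    and I_sub: "I \<subseteq> captive"
    and I_independent: "\<And>u v. u \<in> I \<Longrightarrow> v \<in> I \<Longrightarrow> (u, v) \<notin> parcs G"
    and I_maximal: "\<And>u. u \<in> captive \<Longrightarrow> u \<notin> I \<Longrightarrow> \<exists>v\<in>I. (u, v) \<in> parcs G"
begin

text \<open>The values make two-step entries proper: through a non-captive neighbour the colors are
  0, then 2; from a captive vertex through a captive neighbour they are 2, then 0 or 1. Path edges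
  never have color 2.\<close>

definition col :: "'a set \<Rightarrow> nat" where
  "col e =
     (if e \<subseteq> set P then f e
      else if e \<inter> set P \<noteq> {} then
        if e \<inter> captive = {} then 2 else if e \<inter> I \<noteq> {} then 0 else 1
      else if e \<subseteq> captive then 2 else 0)"

lemma col_less: "col e < 3"
  using f_less[of e] by (simp add: col_def)

lemma captive_outer: "captive \<subseteq> outer"
  by (auto simp: captive_def)

lemma captive_disjoint_path: "captive \<inter> set P = {}"
  by (auto simp: captive_def outer_def)

lemma col_path: "e \<subseteq> set P \<Longrightarrow> col e = f e"
  by (simp add: col_def)

lemma col_contact:
  assumes "u \<in> outer" "x \<in> set P"
  shows "col {u, x} = (if u \<notin> captive then 2 else if u \<in> I then 0 else 1)"
proof -
  have "u \<notin> set P" "x \<notin> captive" "x \<notin> I"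
    using assms captive_disjoint_path I_sub by (auto simp: outer_def)
  then show ?thesis
    using assms(2) by (auto simp: col_def)
qed

lemma col_outer:
  assumes "u \<in> outer" "v \<in> outer"
  shows "col {u, v} = (if u \<in> captive \<and> v \<in> captive then 2 else 0)"
  using assms by (auto simp: col_def outer_def)

text \<open>A hook is a proper way to enter \<open>P\<close> at \<open>x\<close>. Its part
  \<open>h\<close> stays off \<open>P\<close>, hence is disjoint from every segment of
  \<open>P\<close> that continues it.\<close>

definition hook :: "'a list \<Rightarrow> 'a \<Rightarrow> bool" where
  "hook h x \<longleftrightarrow> h \<noteq> [] \<and> set h \<subseteq> outer \<and> x \<in> set P \<and> proper_path G col (h @ [x])"

lemma hook_single:
  assumes "u \<in> outer" "x \<in> contacts u"
  shows "hook [u] x"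
  using assms proper_path_arc by (auto simp: hook_def contacts_def)

lemma hook_double:
  assumes "u \<in> outer" "v \<in> outer" "(u, v) \<in> parcs G" "x \<in> contacts v" "col {u, v} \<noteq> col {v, x}"
  shows "hook [u, v] x"
proof -
  have "proper_path G col ([u] @ v # [x])"
    using assms by - (rule proper_path_join, auto intro: proper_path_arc simp: contacts_def outer_def)
  then show ?thesis
    using assms by (auto simp: hook_def contacts_def)
qed

text \<open>A contiguous block of \<open>P\<close>, possibly reversed, inherits the alternation. The
  form \<open>x # q @ [y]\<close> exposes the two end edges to which hooks are attached.\<close>

lemma path_segment:
  assumes "x \<in> set P" "y \<in> set P" "x \<noteq> y"
  obtains q where "proper_path G col (x # q @ [y])" "set (x # q @ [y]) \<subseteq> set P"
proof -
  have P: "proper_path G col P"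
  proof -
    have "map col (uedges P) = map f (uedges P)"
      using uedges_subset by (auto intro!: col_path)
    then have "distinct_adj (map col (uedges P))"
      using f_alternating by (simp only:)
    then show ?thesis
      using dominating by (simp add: proper_path_iff dominating_path_def)
  qed
  then obtain q where q: "vpath q (with_proj G)" "hd q = x" "last q = y"
    and sub: "(\<exists>xs ys. P = xs @ q @ ys) \<or> (\<exists>xs ys. P = xs @ rev q @ ys)"
    using vpath_subpath[of P x y] assms by (metis proper_path_iff)
  have sublist: "distinct_adj (map col (uedges r))" if "P = xs @ r @ ys" "r \<noteq> []" for xs r ys
  proof -
    obtain a r' where r: "r = a # r'"
      using \<open>r \<noteq> []\<close> by (cases r) auto
    have "distinct_adj (map col (uedges (r @ ys)))"
      using P uedges_append[of xs a "r' @ ys"] that(1) r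
      by (auto simp: proper_path_iff distinct_adj_append_iff)
    moreover obtain b r'' where r: "r = r'' @ [b]"
      using \<open>r \<noteq> []\<close> by (cases r rule: rev_cases) auto
    ultimately show ?thesis
      using uedges_append[of r'' b ys] by (auto simp: distinct_adj_append_iff)
  qed
  have "q \<noteq> []"
    using q(1) by (auto simp: vpath_with_proj_iff)
  have "distinct_adj (map col (uedges q))"
    using sub sublist[of _ q] sublist[of _ "rev q"] \<open>q \<noteq> []\<close>
    by (auto simp: uedges_rev rev_map[symmetric])
  then have "proper_path G col q"
    using q(1) by (simp add: proper_path_iff)
  moreover obtain q' where "q = x # q' @ [y]"
  proof -
    obtain a r where ar: "q = a # r"
      using \<open>q \<noteq> []\<close> by (cases q) auto
    then have "r \<noteq> []"
      using q(2,3) assms(3) by auto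
    then obtain r' b where "r = r' @ [b]"
      by (cases r rule: rev_cases) auto
    then show thesis
      using that ar q(2,3) by auto
  qed
  moreover have "set q \<subseteq> set P"
    using sub by auto
  ultimately show thesis
    using that by blast
qed

lemma linked_path:
  assumes "x \<in> set P" "y \<in> set P" "x \<noteq> y"
  shows "linked col x y"
proof -
  obtain q where "proper_path G col (x # q @ [y])"
    using path_segment[OF assms] by blast
  then show ?thesis
    unfolding linked_def by (intro exI[of _ "x # q @ [y]"]) auto
qed

text \<open>\<open>\<alpha>\<close> and \<open>\<beta>\<close> are the colors of the end edges of
  the segment between \<open>x\<close> and \<open>y\<close>. They are fixed before any hook is
  chosen, so hooks can be picked to avoid them; a hook arriving with color 2 always does.\<close>

lemma link_hooks:
  assumes "x \<in> set P" "y \<in> set P" "x \<noteq> y"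
  obtains \<alpha> \<beta> where "\<alpha> < 2" "\<beta> < 2"
    "\<And>h. hook h x \<Longrightarrow> col {last h, x} \<noteq> \<alpha> \<Longrightarrow> linked col (hd h) y"
    "\<And>h k. hook h x \<Longrightarrow> hook k y \<Longrightarrow> set h \<inter> set k = {} \<Longrightarrow>
       col {last h, x} \<noteq> \<alpha> \<Longrightarrow> col {last k, y} \<noteq> \<beta> \<Longrightarrow> linked col (hd h) (hd k)"
proof -
  obtain q where q: "proper_path G col (x # q @ [y])" "set (x # q @ [y]) \<subseteq> set P"
    using path_segment[OF assms] by blast
  define \<alpha> where "\<alpha> = col {x, hd (q @ [y])}"
  define \<beta> where "\<beta> = col {last (x # q), y}"
  have "hd (q @ [y]) \<in> set P" "last (x # q) \<in> set P"
    using q(2) by (cases q; auto)+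
  then have less: "\<alpha> < 2" "\<beta> < 2"
    using assms f_less by (auto simp: \<alpha>_def \<beta>_def col_path)
  have to_y: "proper_path G col (h @ x # q @ [y])" if h: "hook h x" "col {last h, x} \<noteq> \<alpha>" for h
  proof (rule proper_path_join)
    show "set h \<inter> set (q @ [y]) = {}"
      using h(1) q(2) by (auto simp: hook_def outer_def)
  qed (use h q in \<open>auto simp: hook_def \<alpha>_def\<close>)
  have "linked col (hd h) y" if h: "hook h x" "col {last h, x} \<noteq> \<alpha>" for h
    unfolding linked_def using to_y[OF h] h(1)
    by (intro exI[of _ "h @ x # q @ [y]"]) (auto simp: hook_def)
  moreover have "linked col (hd h) (hd k)"
    if h: "hook h x" "col {last h, x} \<noteq> \<alpha>" and k: "hook k y" "col {last k, y} \<noteq> \<beta>"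
      and disj: "set h \<inter> set k = {}" for h k
  proof -
    have "proper_path G col (rev (k @ [y]))"
      using k(1) unfolding proper_path_rev by (simp add: hook_def)
    then have "proper_path G col ((h @ x # q) @ y # rev k)"
      using to_y[OF h] k disj q(2)
      by - (rule proper_path_join,
        auto simp: hook_def outer_def \<beta>_def hd_rev insert_commute)
    then show ?thesis
      unfolding linked_def using h(1) k(1)
      by (intro exI[of _ "(h @ x # q) @ y # rev k"]) (auto simp: hook_def last_rev)
  qed
  ultimately show thesis
    using that less by blast
qed

lemma link_hooks_same:
  assumes h: "hook h x" and k: "hook k x" and "set h \<inter> set k = {}" "col {last h, x} \<noteq> col {last k, x}"
  shows "linked col (hd h) (hd k)"
proof -
  have "proper_path G col (rev (k @ [x]))"
    using k unfolding proper_path_rev by (simp add: hook_def)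
  then have "proper_path G col (h @ x # rev k)"
    using assms by - (rule proper_path_join, auto simp: hook_def hd_rev insert_commute)
  then show ?thesis
    unfolding linked_def using h k by (intro exI[of _ "h @ x # rev k"]) (auto simp: hook_def last_rev)
qed

text \<open>A non-captive vertex can enter \<open>P\<close> away from any prescribed
  \<open>y\<close>, with color 2. The last clause serves to prove hooks disjoint.\<close>

lemma free_hook:
  assumes u: "u \<in> outer" "u \<notin> captive"
  obtains h x where "hook h x" "hd h = u" "x \<noteq> y" "col {last h, x} = 2"
    "\<And>v. v \<in> set h \<Longrightarrow> v \<noteq> u \<Longrightarrow> (u, v) \<in> parcs G \<and> contacts v \<noteq> {y}"
proof (cases "contacts u = {y}")
  case False
  then obtain x where x: "x \<in> contacts u" "x \<noteq> y"
    using contacts_nonempty[OF u(1)] by blast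
  then have "col {u, x} = 2"
    using u col_contact[of u x] by (simp add: contacts_def)
  then show thesis
    using x hook_single[OF u(1) x(1)] by (intro that[of "[u]" x]) auto
next
  case True
  then obtain v where v: "v \<in> outer" "(u, v) \<in> parcs G" "contacts v \<noteq> {y}"
    using u by (auto simp: captive_def)
  then obtain x where x: "x \<in> contacts v" "x \<noteq> y"
    using contacts_nonempty by blast
  \<comment> \<open>If \<open>v\<close> were captive, its outer neighbour \<open>u\<close> would
    have the same contacts, which \<open>v\<close> was chosen to violate.\<close>
  have "v \<notin> captive"
    using True v u(1) parcs_sym by (auto simp: captive_def)
  then have "col {v, x} = 2" "col {u, v} = 0"
    using v u x(1) by (simp_all add: col_contact col_outer contacts_def)
  then show thesis
    using x v hook_double[OF u(1) v(1,2) x(1)] by (intro that[of "[u, v]" x]) auto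
qed

text \<open>A captive vertex can enter only at \<open>x\<close>, but can avoid any prescribed color
  \<open>\<alpha>\<close>: if the direct edge has it, a detour through an outer neighbour arrives
  with another color.\<close>

lemma captive_hook:
  assumes u: "u \<in> captive" "contacts u = {x}"
  obtains h where "hook h x" "hd h = u" "col {last h, x} \<noteq> \<alpha>"
    "\<And>v. v \<in> set h \<Longrightarrow> v \<noteq> u \<Longrightarrow> (u, v) \<in> parcs G \<and> contacts v = {x}"
proof (cases "col {u, x} = \<alpha>")
  case False
  then show thesis
    using u captive_outer hook_single[of u x] by (intro that[of "[u]"]) auto
next
  case True
  have out: "u \<in> outer"
    using u captive_outer by blast
  have x: "x \<in> set P"
    using u(2) by (auto simp: contacts_def)
  have contacts: "contacts v = {x}" if "v \<in> outer" "(u, v) \<in> parcs G" for v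
    using u that by (auto simp: captive_def)
  \<comment> \<open>A neighbour other than \<open>x\<close> must be outer, since \<open>x\<close> is
    the only neighbour of \<open>u\<close> on \<open>P\<close>.\<close>
  obtain w where w: "(u, w) \<in> parcs G" "w \<noteq> x"
    using second_neighbour[of u x] out by (auto simp: outer_def)
  then have "w \<in> outer"
    using u(2) arc_snd_in_verts[OF w(1)] by (auto simp: outer_def contacts_def)
  have "\<exists>v\<in>outer. (u, v) \<in> parcs G \<and> col {v, x} \<noteq> col {u, x} \<and> col {u, v} \<noteq> col {v, x}"
  proof (cases "w \<in> captive")
    case False
    then show ?thesis
      using w \<open>w \<in> outer\<close> u(1) out x by (intro bexI[of _ w]) (auto simp: col_contact col_outer)
  next
    case True
    \<comment> \<open>If \<open>u\<close> is in \<open>I\<close>, independence puts \<open>w\<close>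
      outside \<open>I\<close>; otherwise maximality gives a neighbour in \<open>I\<close>. The
      contact edges of \<open>u\<close> and \<open>v\<close> then have colors 0 and 1 in some
      order.\<close>
    then obtain v where v: "v \<in> captive" "(u, v) \<in> parcs G" "v \<in> I \<longleftrightarrow> u \<notin> I"
      using I_independent I_maximal[OF u(1)] I_sub w(1) by blast
    then show ?thesis
      using u(1) out x captive_outer by (intro bexI[of _ v]) (auto simp: col_contact col_outer)
  qed
  then obtain v where v: "v \<in> outer" "(u, v) \<in> parcs G"
      "col {v, x} \<noteq> col {u, x}" "col {u, v} \<noteq> col {v, x}"
    by blast
  then have "hook [u, v] x"
    using contacts[of v] out by (intro hook_double) auto
  then show thesis
    using v True contacts by (intro that[of "[u, v]"]) auto
qed

section \<open>Linking all kinds of vertex pairs\<close>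

lemma linked_outer_path:
  assumes "u \<in> outer" "y \<in> set P"
  shows "linked col u y"
proof (cases "u \<in> captive")
  case False
  \<comment> \<open>The target \<open>y\<close> itself is the contact to avoid, so a genuine segment
    of \<open>P\<close> remains to be traversed.\<close>
  obtain h x where h: "hook h x" "hd h = u" "x \<noteq> y" "col {last h, x} = 2"
    using free_hook[OF assms(1) False] by metis
  then have "x \<in> set P"
    by (simp add: hook_def)
  then show ?thesis
    using link_hooks[of x y] h assms(2) by (metis less_irrefl)
next
  case True
  then obtain x where x: "contacts u = {x}"
    by (auto simp: captive_def)
  show ?thesis
  proof (cases "x = y")
    case True
    then show ?thesis
      using x by (auto simp: contacts_def intro: linked_arc)
  next
    case False
    have "x \<in> set P"
      using x by (auto simp: contacts_def)
    \<comment> \<open>The color \<open>\<alpha>\<close> to avoid depends only on \<open>x\<close>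
      and \<open>y\<close>, so the hook of \<open>u\<close> can be chosen afterwards.\<close>
    then obtain \<alpha> where \<alpha>: "\<And>h. hook h x \<Longrightarrow> col {last h, x} \<noteq> \<alpha> \<Longrightarrow> linked col (hd h) y"
      using link_hooks[OF _ assms(2) False] by metis
    obtain h where "hook h x" "hd h = u" "col {last h, x} \<noteq> \<alpha>"
      using captive_hook[OF True x] by metis
    then show ?thesis
      using \<alpha> by metis
  qed
qed

text \<open>\<open>w\<close> enters directly at \<open>y\<close> and \<open>u\<close> elsewhere,
  both with color 2. The hooks are disjoint because a detour vertex of \<open>u\<close> is a
  neighbour of \<open>u\<close>, while \<open>w\<close> is not.\<close>

lemma linked_free_free:
  assumes u: "u \<in> outer" "u \<notin> captive" and w: "w \<in> outer" "w \<notin> captive"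
    and "u \<noteq> w" "(u, w) \<notin> parcs G"
  shows "linked col u w"
proof -
  obtain y where y: "y \<in> contacts w"
    using contacts_nonempty[OF w(1)] by blast
  then have y_path: "y \<in> set P" and "col {w, y} = 2"
    using w by (auto simp: contacts_def col_contact)
  obtain h x where h: "hook h x" "hd h = u" "x \<noteq> y" "col {last h, x} = 2"
    "\<And>v. v \<in> set h \<Longrightarrow> v \<noteq> u \<Longrightarrow> (u, v) \<in> parcs G \<and> contacts v \<noteq> {y}"
    using free_hook[OF u, of y] by metis
  have "x \<in> set P"
    using h(1) by (simp add: hook_def)
  then obtain \<alpha> \<beta> where "\<alpha> < 2" "\<beta> < 2" and link: "\<And>h k. hook h x \<Longrightarrow> hook k y \<Longrightarrow>
      set h \<inter> set k = {} \<Longrightarrow> col {last h, x} \<noteq> \<alpha> \<Longrightarrow> col {last k, y} \<noteq> \<beta> \<Longrightarrow> linked col (hd h) (hd k)"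
    using link_hooks[OF _ y_path h(3)] by metis
  have "set h \<inter> set [w] = {}"
    using h(5) assms(5,6) by auto
  then have "linked col (hd h) (hd [w])"
    using link[OF h(1) hook_single[OF w(1) y]] h(4) \<open>col {w, y} = 2\<close> \<open>\<alpha> < 2\<close> \<open>\<beta> < 2\<close> by simp
  then show ?thesis
    using h(2) by simp
qed

text \<open>The hook of \<open>w\<close> avoids \<open>x\<close>. A common detour vertex would have
  contacts both equal to and different from \<open>{x}\<close>, and nonadjacency excludes the other
  overlaps.\<close>

lemma linked_captive_free:
  assumes u: "u \<in> captive" and w: "w \<in> outer" "w \<notin> captive"
    and "u \<noteq> w" "(u, w) \<notin> parcs G"
  shows "linked col u w"
proof -
  obtain x where x: "contacts u = {x}"
    using u by (auto simp: captive_def)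
  then have x_path: "x \<in> set P"
    by (auto simp: contacts_def)
  obtain k y where k: "hook k y" "hd k = w" "y \<noteq> x" "col {last k, y} = 2"
    "\<And>v. v \<in> set k \<Longrightarrow> v \<noteq> w \<Longrightarrow> (w, v) \<in> parcs G \<and> contacts v \<noteq> {x}"
    using free_hook[OF w, of x] by metis
  have "y \<in> set P"
    using k(1) by (simp add: hook_def)
  then obtain \<alpha> \<beta> where "\<alpha> < 2" "\<beta> < 2" and link: "\<And>h k. hook h x \<Longrightarrow> hook k y \<Longrightarrow>
      set h \<inter> set k = {} \<Longrightarrow> col {last h, x} \<noteq> \<alpha> \<Longrightarrow> col {last k, y} \<noteq> \<beta> \<Longrightarrow> linked col (hd h) (hd k)"
    using link_hooks[OF x_path] k(3) by metis
  obtain h where h: "hook h x" "hd h = u" "col {last h, x} \<noteq> \<alpha>"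
    "\<And>v. v \<in> set h \<Longrightarrow> v \<noteq> u \<Longrightarrow> (u, v) \<in> parcs G \<and> contacts v = {x}"
    using captive_hook[OF u x] by metis
  have "set h \<inter> set k = {}"
    using h(4) k(5) assms(4,5) parcs_sym by blast
  then show ?thesis
    using link[OF h(1) k(1)] h(2,3) k(2,4) \<open>\<beta> < 2\<close> by simp
qed

text \<open>With a common contact, \<open>w\<close> enters directly and \<open>u\<close> arrives
  with a different color. With different contacts, every vertex of a hook has the contact of its
  captive vertex, so the hooks are disjoint.\<close>

lemma linked_captive_captive:
  assumes u: "u \<in> captive" and w: "w \<in> captive" and "u \<noteq> w" "(u, w) \<notin> parcs G"
  shows "linked col u w"
proof -
  obtain x where x: "contacts u = {x}"
    using u by (auto simp: captive_def)
  obtain y where y: "contacts w = {y}"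
    using w by (auto simp: captive_def)
  have xy_path: "x \<in> set P" "y \<in> set P"
    using x y by (auto simp: contacts_def)
  show ?thesis
  proof (cases "x = y")
    case True
    have k: "hook [w] x"
      using w y True captive_outer by (intro hook_single) auto
    obtain h where h: "hook h x" "hd h = u" "col {last h, x} \<noteq> col {w, x}"
      "\<And>v. v \<in> set h \<Longrightarrow> v \<noteq> u \<Longrightarrow> (u, v) \<in> parcs G \<and> contacts v = {x}"
      using captive_hook[OF u x] by metis
    have "set h \<inter> set [w] = {}"
      using h(4) assms(3,4) by auto
    then have "linked col (hd h) (hd [w])"
      using h k by (intro link_hooks_same) auto
    then show ?thesis
      using h(2) by simp
  next
    case False
    then obtain \<alpha> \<beta> where link: "\<And>h k. hook h x \<Longrightarrow> hook k y \<Longrightarrow>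
        set h \<inter> set k = {} \<Longrightarrow> col {last h, x} \<noteq> \<alpha> \<Longrightarrow> col {last k, y} \<noteq> \<beta> \<Longrightarrow> linked col (hd h) (hd k)"
      using link_hooks[OF xy_path] by metis
    obtain h where h: "hook h x" "hd h = u" "col {last h, x} \<noteq> \<alpha>"
      "\<And>v. v \<in> set h \<Longrightarrow> v \<noteq> u \<Longrightarrow> (u, v) \<in> parcs G \<and> contacts v = {x}"
      using captive_hook[OF u x] by metis
    obtain k where k: "hook k y" "hd k = w" "col {last k, y} \<noteq> \<beta>"
      "\<And>v. v \<in> set k \<Longrightarrow> v \<noteq> w \<Longrightarrow> (w, v) \<in> parcs G \<and> contacts v = {y}"
      using captive_hook[OF w y] by metis
    have "contacts v = {x}" if "v \<in> set h" for v
      using h(4) x that by blast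
    moreover have "contacts v = {y}" if "v \<in> set k" for v
      using k(4) y that by blast
    ultimately have "set h \<inter> set k = {}"
      using False by fastforce
    then show ?thesis
      using link[OF h(1) k(1)] h(2,3) k(2,3) by simp
  qed
qed

text \<open>Adjacent pairs are joined by their edge, which is why the linking of outer pairs could
  assume nonadjacency.\<close>

lemma col_proper_path_coloring: "proper_path_coloring G col"
proof -
  have "linked col u w" if "u \<in> pverts G" "w \<in> pverts G" "u \<noteq> w" for u w
  proof (cases "(u, w) \<in> parcs G")
    case True
    then show ?thesis
      by (rule linked_arc)
  next
    case False
    then have "(w, u) \<notin> parcs G"
      using parcs_sym by blast
    with False show ?thesis
      using outer_or_path[OF that(1)] outer_or_path[OF that(2)] that(3)
        linked_path linked_outer_path linked_free_free linked_captive_free linked_captive_captive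
        linked_sym
      by metis
  qed
  then show ?thesis
    by (auto simp: proper_path_coloring_def linked_def)
qed

end

section \<open>From the coloring to the upper bound\<close>

lemma (in dominated_pair_graph) ex_three_coloring:
  obtains c :: "'a set \<Rightarrow> nat" where "\<And>e. c e < 3" "proper_path_coloring G c"
proof -
  obtain f :: "'a set \<Rightarrow> nat" where f: "\<And>e. f e < 2" "distinct_adj (map f (uedges P))"
    using ex_alternating_coloring[of P] dominating by (auto simp: dominating_path_def vpath_def)
  have "finite captive"
    using pair_finite_verts by (rule rev_finite_subset) (auto simp: captive_def outer_def)
  then obtain I where I: "I \<subseteq> captive" "\<And>u v. u \<in> I \<Longrightarrow> v \<in> I \<Longrightarrow> (u, v) \<notin> parcs G"
    "\<And>u. u \<in> captive \<Longrightarrow> u \<notin> I \<Longrightarrow> \<exists>v\<in>I. (u, v) \<in> parcs G"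
    using ex_maximal_independent_set[of captive "\<lambda>u v. (u, v) \<in> parcs G"] parcs_sym
      pair_no_loops[of "(u, u)" for u] by (metis fst_conv snd_conv)
  interpret colored_dominated_pair_graph G P f I
    by unfold_locales (fact f I)+
  show thesis
    using that[of col] col_less col_proper_path_coloring by blast
qed

lemma out_degree_eq_card: "out_degree (with_proj G) v = card {u. (v, u) \<in> parcs G}"
proof -
  have "out_arcs (with_proj G) v = Pair v ` {u. (v, u) \<in> parcs G}"
    by (auto simp: out_arcs_def)
  then show ?thesis
    by (simp add: out_degree_def card_image inj_on_def)
qed

text \<open>The first conclusion ensures that the minimum defining
  \<open>proper_connection_number\<close> is attained; the lower bound for the windmill relies on
  it.\<close>

lemma (in pair_graph) proper_connection_number_le_3:
  assumes "Digraph_Component.connected (with_proj G)" "min_degree G \<ge> 2" "circular_arc_graph G"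
  shows "\<exists>c :: 'a set \<Rightarrow> nat. proper_path_coloring G c" "proper_connection_number G \<le> 3"
proof -
  obtain P where P: "dominating_path G P"
    using circular_arc_graph_dominating_path assms(1,3) by blast
  have "\<exists>u. (v, u) \<in> parcs G \<and> u \<noteq> x" if "v \<in> pverts G" for v x
  proof (rule ccontr)
    assume "\<not> ?thesis"
    then have "{u. (v, u) \<in> parcs G} \<subseteq> {x}"
      by blast
    then have "out_degree (with_proj G) v \<le> 1"
      using card_mono[of "{x}"] by (auto simp: out_degree_eq_card)
    moreover have "min_degree G \<le> out_degree (with_proj G) v"
      unfolding min_degree_def using that pair_finite_verts by (intro Min_le) auto
    ultimately show False
      using assms(2) by simp
  qed
  then interpret dominated_pair_graph G P
    using P by unfold_locales
  obtain c :: "'a set \<Rightarrow> nat" where c: "\<And>e. c e < 3" "proper_path_coloring G c"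
    using ex_three_coloring by blast
  then show "\<exists>c :: 'a set \<Rightarrow> nat. proper_path_coloring G c"
    by blast
  have "proper_connection_number G \<le> card (c ` edges G)"
    unfolding proper_connection_number_def by (rule Least_le) (use c in blast)
  also have "\<dots> \<le> card {..<3 :: nat}"
    using c(1) by (intro card_mono) auto
  finally show "proper_connection_number G \<le> 3"
    by simp
qed

subsection \<open>The windmill of three triangles\<close>

text \<open>The hub is 0 and the triangles are \<open>{0, 1, 2}\<close>, \<open>{0, 3, 4}\<close>,
  \<open>{0, 5, 6}\<close>; \<open>(u + 1) div 2\<close> numbers the triangle of a non-hub vertex
  \<open>u\<close>.\<close>

definition windmill :: "nat pair_pre_digraph" where
  "windmill = \<lparr> pverts = {..6},
     parcs = {(u, v). u \<le> 6 \<and> v \<le> 6 \<and> u \<noteq> v \<and> (u = 0 \<or> v = 0 \<or> (u + 1) div 2 = (v + 1) div 2)} \<rparr>"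

definition mate :: "nat \<Rightarrow> nat" where
  "mate v = (if odd v then v + 1 else v - 1)"

lemma pverts_windmill: "pverts windmill = {..6}"
  by (simp add: windmill_def)

lemma parcs_windmill_iff:
  "(u, v) \<in> parcs windmill \<longleftrightarrow>
     u \<le> 6 \<and> v \<le> 6 \<and> u \<noteq> v \<and> (u = 0 \<or> v = 0 \<or> (u + 1) div 2 = (v + 1) div 2)"
  by (simp add: windmill_def)

lemma parcs_windmill_cases:
  assumes "(u, v) \<in> parcs windmill" "u \<noteq> 0"
  shows "v = 0 \<or> v = mate u"
proof -
  have "u \<in> {1, 2, 3, 4, 5, 6}" "v \<in> {0, 1, 2, 3, 4, 5, 6}"
    using assms by (auto simp: parcs_windmill_iff)
  then show ?thesis
    using assms by (auto simp: parcs_windmill_iff mate_def)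
qed

lemma windmill_mate:
  assumes "v \<noteq> 0" "v \<le> 6"
  shows "(v, mate v) \<in> parcs windmill \<and> mate v \<noteq> 0 \<and> mate v \<noteq> v \<and> mate (mate v) = v"
proof -
  have "v \<in> {1, 2, 3, 4, 5, 6}"
    using assms by auto
  then show ?thesis
    by (auto simp: parcs_windmill_iff mate_def)
qed

section \<open>The windmill is a connected interval graph of minimum degree at least 2\<close>

lemma pair_graph_windmill: "pair_graph windmill"
proof
  have "parcs windmill \<subseteq> {..6} \<times> {..6}"
    by (auto simp: windmill_def)
  then show "finite (parcs windmill)"
    by (rule finite_subset) auto
qed (auto simp: windmill_def symmetric_def sym_def)

lemma connected_windmill: "Digraph_Component.connected (with_proj windmill)"
proof -
  interpret pair_graph windmill
    by (rule pair_graph_windmill)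
  have "u \<rightarrow>\<^sup>*\<^bsub>with_proj windmill\<^esub> 0" if "u \<in> pverts windmill" for u
    using that by (cases "u = 0") (auto simp: pverts_windmill parcs_windmill_iff)
  moreover have "0 \<rightarrow>\<^sup>*\<^bsub>with_proj windmill\<^esub> u" if "u \<in> pverts windmill" for u
    using that by (cases "u = 0") (auto simp: pverts_windmill parcs_windmill_iff)
  ultimately have "strongly_connected (with_proj windmill)"
    by (intro strongly_connectedI) (auto simp: pverts_windmill intro: reachable_trans)
  then show ?thesis
    by (auto simp: connected_def strongly_connected_def intro: reachable_mk_symmetricI)
qed

lemma min_degree_windmill: "min_degree windmill \<ge> 2"
proof -
  have "2 \<le> out_degree (with_proj windmill) v" if "v \<le> 6" for v
  proof -
    have fin: "finite {u. (v, u) \<in> parcs windmill}"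
      by (rule finite_subset[of _ "{..6}"]) (auto simp: parcs_windmill_iff)
    obtain a b where "a \<noteq> b" "{a, b} \<subseteq> {u. (v, u) \<in> parcs windmill}"
    proof (cases "v = 0")
      case True
      then show thesis
        by (intro that[of 1 2]) (auto simp: parcs_windmill_iff)
    next
      case False
      then show thesis
        using \<open>v \<le> 6\<close> windmill_mate[of v] by (intro that[of 0 "mate v"]) (auto simp: parcs_windmill_iff)
    qed
    then show ?thesis
      using card_mono[OF fin, of "{a, b}"] by (simp add: out_degree_eq_card)
  qed
  then show ?thesis
    by (auto simp: min_degree_def pverts_windmill intro!: Min.boundedI)
qed

lemma interval_graph_windmill: "interval_graph windmill"
proof -
  \<comment> \<open>The hub gets the whole line; the two other vertices of a triangle share a single
    point, with different points for different triangles.\<close>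
  define I :: "nat \<Rightarrow> real set" where "I v = (if v = 0 then UNIV else {real ((v + 1) div 2)})" for v
  have "intersection_graph windmill I"
    by (auto simp: intersection_graph_def pverts_windmill parcs_windmill_iff I_def)
  moreover have "is_interval (I v) \<and> I v \<noteq> {}" for v
    by (simp add: I_def is_interval_1)
  ultimately show ?thesis
    unfolding interval_graph_def by blast
qed

text \<open>The hub separates the triangles, so before reaching it a path from \<open>u\<close> can
  visit only \<open>mate u\<close>.\<close>

lemma windmill_path_prefix:
  assumes p: "vpath p (with_proj windmill)" and "hd p = u" "u \<noteq> 0" "last p \<notin> {0, u, mate u}"
  obtains q where "p = [u] @ 0 # q \<or> p = [u, mate u] @ 0 # q"
proof -
  have chain: "successively (\<lambda>u v. (u, v) \<in> parcs windmill) p" and dist: "distinct p" and "p \<noteq> []"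
    and verts: "set p \<subseteq> {..6}"
    using p by (auto simp: vpath_with_proj_iff pverts_windmill)
  then obtain p1 where p1: "p = u # p1"
    using assms(2) by (cases p) auto
  then have "p1 \<noteq> []"
    using assms(4) by auto
  then obtain v p2 where p2: "p1 = v # p2"
    by (cases p1) auto
  have "(u, v) \<in> parcs windmill"
    using chain p1 p2 by simp
  then consider "v = 0" | "v = mate u"
    using parcs_windmill_cases assms(3) by blast
  then show thesis
  proof cases
    case 1
    then show thesis
      using p1 p2 that[of p2] by simp
  next
    case 2
    then have "p2 \<noteq> []"
      using p1 p2 assms(4) by auto
    then obtain w p3 where p3: "p2 = w # p3"
      by (cases p2) auto
    have "mate u \<noteq> 0" "mate (mate u) = u"
      using windmill_mate[of u] assms(3) verts p1 by auto
    moreover have "(mate u, w) \<in> parcs windmill" "w \<noteq> u"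
      using chain dist p1 p2 p3 2 by auto
    ultimately have "w = 0"
      using parcs_windmill_cases by metis
    then show thesis
      using p1 p2 p3 2 that[of p3] by simp
  qed
qed

text \<open>The colors with which a proper path from \<open>u\<close> can enter the hub \<open>0\<close>.\<close>

definition entry_colors :: "(nat set \<Rightarrow> 'c) \<Rightarrow> nat \<Rightarrow> 'c set" where
  "entry_colors c u =
     insert (c {u, 0}) (if c {u, mate u} = c {mate u, 0} then {} else {c {mate u, 0}})"

text \<open>A proper path between different triangles crosses the hub, and its two edges there have
  different colors, one available to each end.\<close>

lemma windmill_entry_colors:
  assumes c: "proper_path_coloring windmill c"
    and uv: "u \<le> 6" "v \<le> 6" "u \<noteq> 0" "v \<noteq> 0" "v \<noteq> u" "v \<noteq> mate u"
  shows "\<exists>a\<in>entry_colors c u. \<exists>b\<in>entry_colors c v. a \<noteq> b"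
proof -
  obtain p where p: "proper_path windmill c p" "hd p = u" "last p = v"
    using c uv unfolding proper_path_coloring_def by (metis atMost_iff pverts_windmill)
  interpret pair_graph windmill
    by (rule pair_graph_windmill)
  have vp: "vpath p (with_proj windmill)" and col: "distinct_adj (map c (uedges p))"
    using p(1) by (auto simp: proper_path_iff)
  have "u \<noteq> mate v"
    using windmill_mate[of v] uv by auto
  obtain q where q: "p = [u] @ 0 # q \<or> p = [u, mate u] @ 0 # q"
    using windmill_path_prefix[OF vp p(2)] p(3) uv by auto
  obtain r where "rev p = [v] @ 0 # r \<or> rev p = [v, mate v] @ 0 # r"
    using windmill_path_prefix[of "rev p" v] vp p uv \<open>u \<noteq> mate v\<close>
    by (auto simp: vpath_rev hd_rev last_rev)
  then have "rev (rev p) = rev ([v] @ 0 # r) \<or> rev (rev p) = rev ([v, mate v] @ 0 # r)"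
    by metis
  then have r: "p = rev r @ 0 # [v] \<or> p = rev r @ 0 # [mate v, v]"
    by simp
  have "distinct p"
    using vp by (auto simp: vpath_with_proj_iff)
  \<comment> \<open>The hub occurs once on the path, so the decompositions found from its two ends
    split at the same place.\<close>
  then have unique: "ys = ys'" if "p = xs @ 0 # ys" "p = xs' @ 0 # ys'" for xs xs' ys ys'
    using that append_Cons_eq_iff[of 0 xs ys xs' ys'] by auto
  have "q = [v] \<or> q = [mate v, v]"
    using q r unique by metis
  then show ?thesis
    using q col by (auto simp: entry_colors_def insert_commute)
qed

text \<open>With two colors, two edges of the triangle agree. Equal hub edges make the detour
  useless; otherwise the edge opposite the hub agrees with one hub edge and blocks the detour over
  it.\<close>

lemma windmill_single_entry_color:
  assumes "card (c ` edges windmill) \<le> 2" "u \<le> 6" "u \<noteq> 0"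
  obtains v \<gamma> where "v \<in> {u, mate u}" "entry_colors c v = {\<gamma>}" "\<gamma> \<in> c ` edges windmill"
proof -
  interpret pair_graph windmill
    by (rule pair_graph_windmill)
  note mate = windmill_mate[OF assms(3,2)]
  let ?C = "c ` edges windmill"
  have fin: "finite ?C"
    using pair_finite_arcs by (simp add: edges_def)
  have in_C: "c {a, b} \<in> ?C" if "(a, b) \<in> parcs windmill" for a b
    using that by (force simp: edges_def)
  have "mate u \<le> 6"
    using mate by (simp add: parcs_windmill_iff)
  then have C: "c {u, 0} \<in> ?C" "c {mate u, 0} \<in> ?C" "c {u, mate u} \<in> ?C"
    using mate assms(2,3) by (auto intro!: in_C simp: parcs_windmill_iff)
  have "\<not> card {c {u, 0}, c {mate u, 0}, c {u, mate u}} = 3"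
    using card_mono[OF fin, of "{c {u, 0}, c {mate u, 0}, c {u, mate u}}"] C assms(1) by auto
  then consider "c {u, 0} = c {mate u, 0}" | "c {u, mate u} = c {mate u, 0}" | "c {u, mate u} = c {u, 0}"
    by (auto simp: card_insert_if split: if_splits)
  then show thesis
  proof cases
    case 1
    then show thesis
      using C by (intro that[of u "c {u, 0}"]) (auto simp: entry_colors_def)
  next
    case 2
    then show thesis
      using C by (intro that[of u "c {u, 0}"]) (auto simp: entry_colors_def)
  next
    case 3
    then show thesis
      using C mate
      by (intro that[of "mate u" "c {mate u, 0}"]) (auto simp: entry_colors_def insert_commute)
  qed
qed

lemma windmill_coloring_card:
  assumes "proper_path_coloring windmill c"
  shows "card (c ` edges windmill) > 2"
proof (rule ccontr)
  interpret pair_graph windmill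
    by (rule pair_graph_windmill)
  let ?C = "c ` edges windmill"
  assume "\<not> card ?C > 2"
  then have card: "card ?C \<le> 2"
    by simp
  have fin: "finite ?C"
    using pair_finite_arcs by (simp add: edges_def)
  have mates: "mate 1 = 2" "mate 2 = 1" "mate 3 = 4" "mate 4 = 3" "mate 5 = 6" "mate 6 = 5"
    by (simp_all add: mate_def)
  obtain v1 \<gamma>1 where 1: "v1 \<in> {1, 2}" "entry_colors c v1 = {\<gamma>1}" "\<gamma>1 \<in> ?C"
    using windmill_single_entry_color[OF card, of 1] mates by auto
  obtain v2 \<gamma>2 where 2: "v2 \<in> {3, 4}" "entry_colors c v2 = {\<gamma>2}" "\<gamma>2 \<in> ?C"
    using windmill_single_entry_color[OF card, of 3] mates by auto
  obtain v3 \<gamma>3 where 3: "v3 \<in> {5, 6}" "entry_colors c v3 = {\<gamma>3}" "\<gamma>3 \<in> ?C"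
    using windmill_single_entry_color[OF card, of 5] mates by auto
  \<comment> \<open>Vertices of different triangles need different entry colors; as each has only
    one, three distinct colors arise.\<close>
  have "\<gamma>1 \<noteq> \<gamma>2"
    using windmill_entry_colors[OF assms, of v1 v2] 1 2 mates by auto
  moreover have "\<gamma>1 \<noteq> \<gamma>3"
    using windmill_entry_colors[OF assms, of v1 v3] 1 3 mates by auto
  moreover have "\<gamma>2 \<noteq> \<gamma>3"
    using windmill_entry_colors[OF assms, of v2 v3] 2 3 mates by auto
  ultimately have "card {\<gamma>1, \<gamma>2, \<gamma>3} = 3"
    by simp
  moreover have "card {\<gamma>1, \<gamma>2, \<gamma>3} \<le> card ?C"
    using 1 2 3 fin by (intro card_mono) auto
  ultimately show False
    using card by simp
qed

lemma proper_connection_number_windmill: "proper_connection_number windmill = 3"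
proof -
  interpret pair_graph windmill
    by (rule pair_graph_windmill)
  note le_3 = proper_connection_number_le_3[OF connected_windmill min_degree_windmill
      interval_graph_imp_circular_arc_graph[OF interval_graph_windmill]]
  \<comment> \<open>Existence shows that some coloring realizes the least value, so the bound valid
    for every coloring applies to it.\<close>
  have "\<exists>k. \<exists>c :: nat set \<Rightarrow> nat. proper_path_coloring windmill c \<and> card (c ` edges windmill) = k"
    using le_3(1) by blast
  then have "\<exists>c :: nat set \<Rightarrow> nat. proper_path_coloring windmill c \<and>
      card (c ` edges windmill) = proper_connection_number windmill"
    unfolding proper_connection_number_def by (rule LeastI_ex)
  then have "proper_connection_number windmill > 2"
    using windmill_coloring_card by metis
  then show ?thesis
    using le_3(2) by simp
qed

theorem theorem4p2:
  shows "(\<forall>G :: 'a pair_pre_digraph.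
            pair_graph G \<and> Digraph_Component.connected (with_proj G) \<and> min_degree G \<ge> 2 \<and>
            (interval_graph G \<or> circular_arc_graph G)
            \<longrightarrow> proper_connection_number G \<le> 3) \<and>
         (\<exists>G :: nat pair_pre_digraph.
            pair_graph G \<and> Digraph_Component.connected (with_proj G) \<and> min_degree G \<ge> 2 \<and>
            interval_graph G \<and> proper_connection_number G = 3) \<and>
         (\<exists>G :: nat pair_pre_digraph.
            pair_graph G \<and> Digraph_Component.connected (with_proj G) \<and> min_degree G \<ge> 2 \<and>
            circular_arc_graph G \<and> proper_connection_number G = 3)"
proof (intro conjI allI impI)
  fix G :: "'a pair_pre_digraph"
  assume "pair_graph G \<and> Digraph_Component.connected (with_proj G) \<and> min_degree G \<ge> 2 \<and>
    (interval_graph G \<or> circular_arc_graph G)"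
  then show "proper_connection_number G \<le> 3"
    using pair_graph.proper_connection_number_le_3(2) interval_graph_imp_circular_arc_graph by blast
next
  note windmill = pair_graph_windmill connected_windmill min_degree_windmill
    interval_graph_windmill proper_connection_number_windmill
  show "\<exists>G :: nat pair_pre_digraph.
      pair_graph G \<and> Digraph_Component.connected (with_proj G) \<and> min_degree G \<ge> 2 \<and>
      interval_graph G \<and> proper_connection_number G = 3"
    using windmill by blast
  show "\<exists>G :: nat pair_pre_digraph.
      pair_graph G \<and> Digraph_Component.connected (with_proj G) \<and> min_degree G \<ge> 2 \<and>
      circular_arc_graph G \<and> proper_connection_number G = 3"
    using windmill interval_graph_imp_circular_arc_graph by blast
qed

end
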